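(* Let $P(x_1,x_2)$ be a homogeneous polynomial of degree at least $2$ with constant coefficients, and let $$Lu=P\Bigl(-i\frac{\partial}{\partial x_1},-i\frac{\partial}{\partial x_2}\Bigr)u .$$ The operator $L$ is hypoelliptic (on the torus) if and only if for every real root $\alpha$ of the polynomial $P(x,1)$ there exist constants $C>0$ and $k$ such that $$\Bigl|\alpha-\frac pq\Bigr|>\frac{C}{q^k}$$ for every rational $p/q$ sufficiently close to $\alpha$.
   Context: For $m\in\mathbb R$, $H^m$ is the space of formal Fourier series $f=\sum_{n\in\mathbb Z\oplus\mathbb Z}f_n e^{inx}$ ($f_n\in\mathbb C$, $n=(n_1,n_2)$, $x=(x_1,x_2)$, $nx=n_1x_1+n_2x_2$) with finite norm $\|f\|_m^2=\sum_n(1+n\cdot n)^m|f_n|^2$ (periodic Sobolev spaces). $H^\infty=\bigcap_m H^m$ and $H^{-\infty}=\bigcup_m H^m$. The operator $L$ acts by $L\bigl(\sum_n f_ne^{inx}\bigr)=\sum_n P(n)f_ne^{inx}$. $L$ is called hypoelliptic if for any $u\in H^{-\infty}$ the inclusion $Lu\in H^\infty$ implies $u\in H^\infty$. In fractions $p/q$, $p$ and $q$ are integers with $q>0$.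
   Formalization: The condition P(1,0) ≠ 0 is added to the right-hand side of the equivalence; without it the claim fails, e.g. for P = x_2^2, where P(x,1) = 1 has no real root but L annihilates every function of x_1 alone, so L is not hypoelliptic. *)

theory Defs
  imports "HOL-Analysis.Analysis" "HOL-Computational_Algebra.Polynomial"
begin

text \<open>A formal Fourier series $\sum_n f_n e^{inx}$ on the two-dimensional torus is represented
  by its coefficient family $n \mapsto f_n$; no convergence is required.\<close>

type_synonym fourier = "int \<times> int \<Rightarrow> complex"

fun sobolev_weight :: "int \<times> int \<Rightarrow> real" where
  "sobolev_weight (n1, n2) = 1 + (of_int n1)\<^sup>2 + (of_int n2)\<^sup>2"

definition sobolev :: "real \<Rightarrow> fourier set" where
  "sobolev m = {f. (\<lambda>n. sobolev_weight n powr m * (cmod (f n))\<^sup>2) summable_on UNIV}"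

definition sobolev_inf :: "fourier set" where
  "sobolev_inf = (\<Inter>m. sobolev m)"

definition sobolev_minf :: "fourier set" where
  "sobolev_minf = (\<Union>m. sobolev m)"

definition hypoelliptic :: "(fourier \<Rightarrow> fourier) \<Rightarrow> bool" where
  "hypoelliptic L \<longleftrightarrow> (\<forall>u\<in>sobolev_minf. L u \<in> sobolev_inf \<longrightarrow> u \<in> sobolev_inf)"

text \<open>Termwise differentiation of $\sum_n f_n e^{i(n_1x_1+n_2x_2)}$.\<close>

fun partial1 :: "fourier \<Rightarrow> fourier" where
  "partial1 f (n1, n2) = \<i> * of_int n1 * f (n1, n2)"

fun partial2 :: "fourier \<Rightarrow> fourier" where
  "partial2 f (n1, n2) = \<i> * of_int n2 * f (n1, n2)"

text \<open>A polynomial in $x_1, x_2$ is an element of $\mathbb{C}[x_2][x_1]$: the coefficient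
  of $x_1^i x_2^j$ in \<open>P\<close> is \<open>coeff (coeff P i) j\<close>.\<close>

definition homogeneous2 :: "nat \<Rightarrow> complex poly poly \<Rightarrow> bool" where
  "homogeneous2 d P \<longleftrightarrow> P \<noteq> 0 \<and> (\<forall>i j. coeff (coeff P i) j \<noteq> 0 \<longrightarrow> i + j = d)"

text \<open>\<open>subst2 P b\<close> is the one-variable polynomial $P(x, b)$.\<close>

definition subst2 :: "complex poly poly \<Rightarrow> complex \<Rightarrow> complex poly" where
  "subst2 P b = map_poly (\<lambda>c. poly c b) P"

definition eval2 :: "complex poly poly \<Rightarrow> complex \<Rightarrow> complex \<Rightarrow> complex" where
  "eval2 P a b = poly (subst2 P b) a"

definition D1 :: "fourier \<Rightarrow> fourier" where
  "D1 f = (\<lambda>n. - \<i> * partial1 f n)"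

definition D2 :: "fourier \<Rightarrow> fourier" where
  "D2 f = (\<lambda>n. - \<i> * partial2 f n)"

text \<open>The operator $P(-i\,\partial/\partial x_1, -i\,\partial/\partial x_2)$.\<close>

definition diff_op :: "complex poly poly \<Rightarrow> fourier \<Rightarrow> fourier" where
  "diff_op P u = (\<lambda>n. \<Sum>i\<le>degree P. \<Sum>j\<le>degree (coeff P i).
     coeff (coeff P i) j * (D1 ^^ i) ((D2 ^^ j) u) n)"

lemma D1_iterate:
  "(D1 ^^ i) u (n1, n2) = of_int n1 ^ i * u (n1, n2)"
  by (induction i) (simp_all add: D1_def algebra_simps)

lemma D2_iterate:
  "(D2 ^^ j) u (n1, n2) = of_int n2 ^ j * u (n1, n2)"
  by (induction j) (simp_all add: D2_def algebra_simps)

lemma eval2_altdef: "eval2 P a b = (\<Sum>i\<le>degree P. poly (coeff P i) b * a ^ i)"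
proof -
  have "eval2 P a b = (\<Sum>i\<le>degree (subst2 P b). coeff (subst2 P b) i * a ^ i)"
    by (simp add: eval2_def poly_altdef)
  also have "\<dots> = (\<Sum>i\<le>degree P. coeff (subst2 P b) i * a ^ i)"
    by (rule sum.mono_neutral_left)
       (auto simp: subst2_def coeff_eq_0 intro: order_trans[OF _ map_poly_degree_leq])
  also have "\<dots> = (\<Sum>i\<le>degree P. poly (coeff P i) b * a ^ i)"
    by (simp add: subst2_def coeff_map_poly)
  finally show ?thesis .
qed

lemma diff_op_multiplier:
  "diff_op P u (n1, n2) = eval2 P (of_int n1) (of_int n2) * u (n1, n2)"
  by (simp add: diff_op_def D1_iterate D2_iterate eval2_altdef poly_altdef
      sum_distrib_left sum_distrib_right mult_ac)

text \<open>The bound is also required of $p/q = \alpha$ itself, so it fails whenever $\alpha$ is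
  rational. The fraction need not be reduced.\<close>

definition diophantine_bound :: "real \<Rightarrow> bool" where
  "diophantine_bound \<alpha> \<longleftrightarrow>
     (\<exists>C>0. \<exists>k::real. \<exists>\<epsilon>>0. \<forall>p q :: int. q > 0 \<longrightarrow>
        \<bar>\<alpha> - of_int p / of_int q\<bar> < \<epsilon> \<longrightarrow>
        \<bar>\<alpha> - of_int p / of_int q\<bar> > C / of_int q powr k)"

end

theory Submission
  imports Defs "HOL-Computational_Algebra.Fundamental_Theorem_Algebra"
begin

text \<open>On Fourier coefficients the operator is multiplication by the symbol \<open>P(n\<^sub>1, n\<^sub>2)\<close>.
  Such a multiplier is hypoelliptic exactly when the symbol is bounded below by some power of
  the Sobolev weight at all but finitely many frequencies (\<open>hypoelliptic_multiplier_iff\<close>): with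
  such a bound, division by the symbol costs only finitely many derivatives; without it, there
  are infinitely many frequencies at which the symbol decays faster than any power, and the sum
  of the corresponding exponentials is a non-smooth distribution with smooth image.

  The question is thus how small \<open>P\<close> can be on the integer lattice. By homogeneity
  \<open>P(p, q) = q\<^sup>d Q(p/q)\<close> with \<open>Q(x) = P(x, 1)\<close>, while on the axis \<open>P(p, 0) = p\<^sup>d P(1, 0)\<close>.
  The axis accounts for the condition \<open>P(1, 0) \<noteq> 0\<close>. Off the axis, write \<open>Q\<close> as a product of
  linear factors. A root off the real line keeps a positive distance from all rationals, and a
  real root has at least a power-of-\<open>q\<close> distance from \<open>p/q\<close> by the Diophantine condition;
  the product of these bounds bounds the symbol below (\<open>symbol_lower_bound\<close>).
  Conversely, \<open>\<bar>Q(x)\<bar> \<le> M \<bar>\<alpha> - x\<bar>\<close> near a real root \<open>\<alpha>\<close>, so a lower bound on the symbol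
  at a multiple of \<open>(p, q)\<close> forces \<open>p/q\<close> away from \<open>\<alpha>\<close>
  (\<open>diophantine_bound_if_symbol_lower_bound\<close>).\<close>

section \<open>Sobolev weights on the lattice\<close>

lemma sobolev_weight_ge_1: "sobolev_weight n \<ge> 1"
  by (cases n) simp

lemma finite_sobolev_weight_less: "finite {n. sobolev_weight n < R}"
proof -
  obtain N :: nat where N: "R \<le> real N" using real_arch_simple by blast
  have "{n. sobolev_weight n < R} \<subseteq> {- int N..int N} \<times> {- int N..int N}"
  proof (clarsimp simp del: of_int_power)
    fix a b :: int assume *: "1 + (real_of_int a)\<^sup>2 + (real_of_int b)\<^sup>2 < R"
    have bound: "- int N \<le> c \<and> c \<le> int N" if "1 + (real_of_int c)\<^sup>2 < R" for c
    proof -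
      have "c\<^sup>2 < int N"
        using that N by (simp flip: of_int_power)
      moreover have "\<bar>c\<bar> \<le> c\<^sup>2"
        by (cases "c = 0") (use self_le_power[of "\<bar>c\<bar>" 2] in auto)
      ultimately show ?thesis by linarith
    qed
    have "1 + (real_of_int a)\<^sup>2 < R" "1 + (real_of_int b)\<^sup>2 < R"
      using * zero_le_power2[of "real_of_int a"] zero_le_power2[of "real_of_int b"] by linarith+
    then show "- int N \<le> a \<and> a \<le> int N \<and> - int N \<le> b \<and> b \<le> int N"
      using bound by blast
  qed
  then show ?thesis by (rule finite_subset) auto
qed

lemma summable_on_inverse_one_plus_square:
  "(\<lambda>a::int. 1 / (1 + (real_of_int a)\<^sup>2)) summable_on UNIV"
proof -
  let ?g = "\<lambda>a::int. 1 / (1 + (real_of_int a)\<^sup>2)"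
  have sm: "summable (\<lambda>n. 1 / (1 + (real n)\<^sup>2))"
  proof (rule summable_comparison_test)
    show "summable (\<lambda>n. 1 / (real n)\<^sup>2)"
      using inverse_power_summable[of 2, where 'a=real] by (simp add: inverse_eq_divide)
    show "\<exists>N. \<forall>n\<ge>N. norm (1 / (1 + (real n)\<^sup>2)) \<le> 1 / (real n)\<^sup>2"
      by (rule exI[of _ 1]) (auto intro!: divide_left_mono mult_pos_pos add_pos_nonneg)
  qed
  have "(\<lambda>n. 1 / (1 + (real n)\<^sup>2)) summable_on UNIV"
    using sm by (intro norm_summable_imp_summable_on) simp
  then have "(?g \<circ> int) summable_on UNIV" "(?g \<circ> (\<lambda>n. - int n)) summable_on UNIV"
    by (simp_all add: o_def)
  then have "?g summable_on range int" "?g summable_on range (\<lambda>n. - int n)"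
    by (subst summable_on_reindex; simp add: inj_on_def)+
  then have "?g summable_on (range int \<union> range (\<lambda>n. - int n))"
    by (rule summable_on_union)
  moreover have "range int \<union> range (\<lambda>n. - int n) = UNIV"
    using int_cases2 by blast
  ultimately show ?thesis by simp
qed

text \<open>The weight satisfies \<open>(1 + a\<^sup>2 + b\<^sup>2)\<^sup>2 \<ge> (1 + a\<^sup>2)(1 + b\<^sup>2)\<close>, so every finite partial
  sum over the lattice is at most the square of a convergent one-dimensional sum.\<close>

lemma summable_on_sobolev_weight: "(\<lambda>n. sobolev_weight n powr (-2)) summable_on UNIV"
proof (rule nonneg_bdd_above_summable_on)
  let ?g = "\<lambda>a::int. 1 / (1 + (real_of_int a)\<^sup>2)"
  have "sum (\<lambda>n. sobolev_weight n powr (-2)) F \<le> (infsum ?g UNIV)\<^sup>2" if "finite F" for F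
  proof -
    define A where "A = fst ` F \<union> snd ` F"
    have A: "finite A" "F \<subseteq> A \<times> A"
      using that by (force simp: A_def)+
    have le: "sobolev_weight (a, b) powr (-2) \<le> ?g a * ?g b" for a b
    proof -
      have "(1 + (real_of_int a)\<^sup>2) * (1 + (real_of_int b)\<^sup>2)
              \<le> (1 + (real_of_int a)\<^sup>2 + (real_of_int b)\<^sup>2)\<^sup>2"
        using mult_nonneg_nonneg[OF zero_le_power2[of "real_of_int a"] zero_le_power2[of "real_of_int b"]]
          zero_le_power2[of "real_of_int a"] zero_le_power2[of "real_of_int b"]
          zero_le_power2[of "(real_of_int a)\<^sup>2"] zero_le_power2[of "(real_of_int b)\<^sup>2"]
        by (simp add: power2_eq_square algebra_simps)
      moreover have "(1 + (real_of_int a)\<^sup>2) * (1 + (real_of_int b)\<^sup>2) > 0"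
        by (intro mult_pos_pos add_pos_nonneg) auto
      moreover have "sobolev_weight (a, b) powr (-2) = 1 / (sobolev_weight (a, b))\<^sup>2"
        using sobolev_weight_ge_1[of "(a, b)"]
        by (simp add: powr_minus powr_numeral inverse_eq_divide)
      ultimately show ?thesis
        by (simp add: frac_le)
    qed
    have "sum (\<lambda>n. sobolev_weight n powr (-2)) F
            \<le> sum (\<lambda>n. sobolev_weight n powr (-2)) (A \<times> A)"
      using A by (intro sum_mono2) auto
    also have "\<dots> \<le> (\<Sum>(a, b)\<in>A \<times> A. ?g a * ?g b)"
      using le by (intro sum_mono) (auto simp del: sobolev_weight.simps)
    also have "\<dots> = (sum ?g A)\<^sup>2"
      by (simp add: sum.cartesian_product[symmetric] sum_product power2_eq_square)
    also have "\<dots> \<le> (infsum ?g UNIV)\<^sup>2"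
      using A by (intro power_mono finite_sum_le_infsum summable_on_inverse_one_plus_square sum_nonneg) auto
    finally show ?thesis .
  qed
  then show "bdd_above (sum (\<lambda>n. sobolev_weight n powr (-2)) ` {F. F \<subseteq> UNIV \<and> finite F})"
    by (intro bdd_aboveI[of _ "(infsum ?g UNIV)\<^sup>2"]) auto
qed simp

section \<open>Hypoelliptic Fourier multipliers\<close>

lemma summable_on_real_comparison:
  fixes f g :: "'a \<Rightarrow> real"
  assumes "g summable_on A" "\<And>x. x \<in> A \<Longrightarrow> 0 \<le> f x" "\<And>x. x \<in> A \<Longrightarrow> f x \<le> g x"
  shows "f summable_on A"
  using summable_on_comparison_test[OF assms(1)] assms by auto

text \<open>Sobolev regularity does not see finitely many coefficients, so a domination by a summable
  family is only needed off a finite set.\<close>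

lemma sobolevI_almost_all:
  assumes "finite E" "h summable_on UNIV"
    and "\<And>n. n \<notin> E \<Longrightarrow> sobolev_weight n powr m * (cmod (f n))\<^sup>2 \<le> h n"
  shows "f \<in> sobolev m"
proof -
  let ?g = "\<lambda>n. sobolev_weight n powr m * (cmod (f n))\<^sup>2"
  have "h summable_on - E"
    using assms(2) by (rule summable_on_subset_banach) simp
  then have "?g summable_on - E"
    by (rule summable_on_real_comparison) (use assms(3) in auto)
  then have "?g summable_on (E \<union> - E)"
    using summable_on_finite[OF assms(1)] by (intro summable_on_union)
  then show ?thesis by (simp add: sobolev_def)
qed

text \<open>Dividing by the symbol loses at most a factor \<open>w\<^sup>k\<close> of the weight \<open>w\<close>, hence \<open>2k\<close> in the
  exponent of the squared norm. As membership of the image in every \<open>H\<^sup>m\<close> is known, this loss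
  is harmless.\<close>

lemma hypoelliptic_multiplier_if_lower_bound:
  assumes lower: "\<And>n. sobolev_weight n \<ge> R \<Longrightarrow> cmod (\<sigma> n) \<ge> sobolev_weight n powr (- k)"
  shows "hypoelliptic (\<lambda>u n. \<sigma> n * u n)"
proof -
  have "u \<in> sobolev m" if u: "(\<lambda>n. \<sigma> n * u n) \<in> sobolev_inf" for u m
  proof (rule sobolevI_almost_all)
    show "finite {n. sobolev_weight n < R}" by (rule finite_sobolev_weight_less)
    show "(\<lambda>n. sobolev_weight n powr (m + 2 * k) * (cmod (\<sigma> n * u n))\<^sup>2) summable_on UNIV"
      using u by (simp add: sobolev_inf_def sobolev_def)
    fix n assume "n \<notin> {n. sobolev_weight n < R}"
    then have low: "cmod (\<sigma> n) \<ge> sobolev_weight n powr (- k)" using lower by simp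
    have pos: "sobolev_weight n > 0" using sobolev_weight_ge_1[of n] by linarith
    have "sobolev_weight n powr m
            = sobolev_weight n powr (m + 2 * k) * (sobolev_weight n powr (- k))\<^sup>2"
      using pos by (simp add: power2_eq_square flip: powr_add)
    also have "\<dots> \<le> sobolev_weight n powr (m + 2 * k) * (cmod (\<sigma> n))\<^sup>2"
      using low by (intro mult_left_mono power_mono) auto
    finally have "sobolev_weight n powr m * (cmod (u n))\<^sup>2 \<le>
        sobolev_weight n powr (m + 2 * k) * (cmod (\<sigma> n))\<^sup>2 * (cmod (u n))\<^sup>2"
      by (intro mult_right_mono) auto
    then show "sobolev_weight n powr m * (cmod (u n))\<^sup>2 \<le>
        sobolev_weight n powr (m + 2 * k) * (cmod (\<sigma> n * u n))\<^sup>2"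
      by (simp add: norm_mult power_mult_distrib mult.assoc)
  qed
  then show ?thesis by (auto simp: hypoelliptic_def sobolev_inf_def)
qed

text \<open>Otherwise pick frequencies \<open>n\<^sub>N\<close> of weight at least \<open>N\<close> at which the symbol is below
  the \<open>-N\<close>-th power of the weight, and let \<open>u\<close> be the indicator of the set of all of them.
  This \<open>u\<close> has bounded coefficients, so it is a distribution, and the multiplier makes them
  decay rapidly; but infinitely many of them are 1, so \<open>u\<close> is not even square integrable.\<close>

lemma lower_bound_if_hypoelliptic_multiplier:
  assumes hyp: "hypoelliptic (\<lambda>u n. \<sigma> n * u n)"
  shows "\<exists>k R. \<forall>n. sobolev_weight n \<ge> R \<longrightarrow> cmod (\<sigma> n) \<ge> sobolev_weight n powr (- k)"
proof (rule ccontr)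
  assume "\<not> ?thesis"
  then have "\<forall>N::nat. \<exists>n. sobolev_weight n \<ge> real N \<and> cmod (\<sigma> n) < sobolev_weight n powr (- real N)"
    by (meson not_le)
  then obtain \<nu> where \<nu>: "\<And>N. sobolev_weight (\<nu> N) \<ge> real N"
      "\<And>N. cmod (\<sigma> (\<nu> N)) < sobolev_weight (\<nu> N) powr (- real N)"
    by metis
  define u :: fourier where "u n = of_bool (n \<in> range \<nu>)" for n
  have "u \<in> sobolev (-2)"
    by (rule sobolevI_almost_all[of "{}", OF _ summable_on_sobolev_weight]) (auto simp: u_def)
  then have minf: "u \<in> sobolev_minf" by (auto simp: sobolev_minf_def)
  have "(\<lambda>n. \<sigma> n * u n) \<in> sobolev m" for m
  proof -
    \<comment> \<open>Frequencies beyond index \<open>K\<close> contribute at most \<open>w\<^sup>m w\<^bsup>-2K\<^esup>\<close>, which is to be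
      below the summable \<open>w\<^bsup>-2\<^esup>\<close>.\<close>
    obtain K :: nat where K: "m + 2 \<le> 2 * real K"
      using real_arch_simple[of "(m + 2) / 2"] by (auto simp: mult.commute)
    show ?thesis
    proof (rule sobolevI_almost_all[OF _ summable_on_sobolev_weight])
      show "finite (\<nu> ` {..<K})" by simp
      fix n assume n: "n \<notin> \<nu> ` {..<K}"
      show "sobolev_weight n powr m * (cmod (\<sigma> n * u n))\<^sup>2 \<le> sobolev_weight n powr - 2"
      proof (cases "n \<in> range \<nu>")
        case True
        then obtain N where N: "n = \<nu> N" by blast
        with n have "K \<le> N" by (metis image_eqI lessThan_iff not_le)
        note w = sobolev_weight_ge_1[of n]
        have "cmod (\<sigma> n) \<le> sobolev_weight n powr (- real N)" using \<nu>(2)[of N] N by simp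
        also have "\<dots> \<le> sobolev_weight n powr (- real K)"
          using w \<open>K \<le> N\<close> by (intro powr_mono) auto
        finally have "(cmod (\<sigma> n))\<^sup>2 \<le> (sobolev_weight n powr (- real K))\<^sup>2"
          by (intro power_mono) auto
        then have "sobolev_weight n powr m * (cmod (\<sigma> n))\<^sup>2
            \<le> sobolev_weight n powr m * (sobolev_weight n powr (- real K))\<^sup>2"
          by (intro mult_left_mono) auto
        also have "\<dots> = sobolev_weight n powr (m - 2 * real K)"
          using w by (simp add: power2_eq_square flip: powr_add)
        also have "\<dots> \<le> sobolev_weight n powr (-2)"
          using w K by (intro powr_mono) auto
        finally show ?thesis using True by (simp add: u_def)
      qed (simp add: u_def)
    qed
  qed
  then have "(\<lambda>n. \<sigma> n * u n) \<in> sobolev_inf" by (auto simp: sobolev_inf_def)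
  with hyp minf have "u \<in> sobolev 0"
    by (auto simp: hypoelliptic_def sobolev_inf_def)
  moreover have "sobolev_weight n \<noteq> 0" for n
    using sobolev_weight_ge_1[of n] by linarith
  ultimately have "(\<lambda>n. (cmod (u n))\<^sup>2) summable_on UNIV"
    by (simp add: sobolev_def)
  then have "(\<lambda>n. (cmod (u n))\<^sup>2) summable_on range \<nu>"
    by (rule summable_on_subset_banach) simp
  then have "(\<lambda>n. 1::real) summable_on range \<nu>"
    by (rule summable_on_cong[THEN iffD1, rotated]) (auto simp: u_def)
  then have "finite (range \<nu>)"
    using infsum_diverge_constant[of "range \<nu>" "1::real"] by auto
  then have "finite (sobolev_weight ` range \<nu>)" by simp
  then obtain B where "\<And>N. sobolev_weight (\<nu> N) \<le> B"
    by (meson bdd_above_finite bdd_above.E rangeI imageI)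
  moreover obtain N :: nat where "B < real N" using reals_Archimedean2 by blast
  ultimately show False using \<nu>(1)[of N] by (meson not_le order_trans)
qed

lemma hypoelliptic_multiplier_iff:
  "hypoelliptic (\<lambda>u n. \<sigma> n * u n) \<longleftrightarrow>
     (\<exists>k R. \<forall>n. sobolev_weight n \<ge> R \<longrightarrow> cmod (\<sigma> n) \<ge> sobolev_weight n powr (- k))"
  using hypoelliptic_multiplier_if_lower_bound lower_bound_if_hypoelliptic_multiplier by metis

section \<open>Homogeneous polynomials\<close>

definition symbol :: "complex poly poly \<Rightarrow> int \<times> int \<Rightarrow> complex" where
  "symbol P n = eval2 P (of_int (fst n)) (of_int (snd n))"

lemma diff_op_eq_multiplier: "diff_op P = (\<lambda>u n. symbol P n * u n)"
  by (auto simp: fun_eq_iff symbol_def diff_op_multiplier)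

text \<open>Homogeneity is a condition on coefficients; as an identity of values it allows
  the symbol to be expressed by \<open>P(x, 1)\<close>.\<close>

lemma eval2_homogeneous:
  assumes "homogeneous2 d P"
  shows "eval2 P (t * a) (t * b) = t ^ d * eval2 P a b"
proof -
  have *: "coeff (coeff P i) j * (t * b) ^ j * (t * a) ^ i = t ^ d * (coeff (coeff P i) j * b ^ j * a ^ i)"
    for i j
  proof (cases "coeff (coeff P i) j = 0")
    case False
    with assms have "i + j = d" by (auto simp: homogeneous2_def)
    then have "t ^ d = t ^ i * t ^ j" by (auto simp: power_add)
    then show ?thesis by (simp add: power_mult_distrib)
  qed simp
  show ?thesis
    by (simp only: eval2_altdef poly_altdef sum_distrib_left sum_distrib_right *)
qed

lemma eval2_one_right: "eval2 P a 1 = poly (subst2 P 1) a"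
  by (simp add: eval2_def)

text \<open>For each power of \<open>x\<^sub>1\<close> a homogeneous polynomial has at most one monomial, so setting
  \<open>x\<^sub>2 = 1\<close> cannot produce cancellation.\<close>

lemma subst2_1_nonzero:
  assumes "homogeneous2 d P"
  shows "subst2 P 1 \<noteq> 0"
proof -
  from assms obtain i j where ij: "coeff (coeff P i) j \<noteq> 0"
    unfolding homogeneous2_def by (metis leading_coeff_0_iff)
  have "coeff P i = monom (coeff (coeff P i) j) j"
  proof (rule poly_eqI)
    fix l
    have "i + j = d" "coeff (coeff P i) l = 0 \<or> i + l = d"
      using assms ij by (auto simp: homogeneous2_def)
    then show "coeff (coeff P i) l = coeff (monom (coeff (coeff P i) j) j) l"
      by auto
  qed
  then have "poly (coeff P i) 1 = coeff (coeff P i) j"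
    by (metis poly_monom power_one mult.right_neutral)
  then have "coeff (subst2 P 1) i \<noteq> 0"
    using ij by (simp add: subst2_def coeff_map_poly)
  then show ?thesis by auto
qed

lemma symbol_eq_fraction:
  assumes "homogeneous2 d P" "q \<noteq> 0"
  shows "cmod (symbol P (p, q)) =
    \<bar>real_of_int q\<bar> ^ d * cmod (poly (subst2 P 1) (of_real (of_int p / of_int q)))"
proof -
  have "symbol P (p, q) = of_int q ^ d * eval2 P (of_int p / of_int q) 1"
    using eval2_homogeneous[OF assms(1), of "of_int q" "of_int p / of_int q" 1] assms(2)
    by (simp add: symbol_def)
  then show ?thesis
    by (simp add: eval2_one_right norm_mult norm_power)
qed

lemma symbol_axis:
  assumes "homogeneous2 d P"
  shows "symbol P (p, 0) = of_int p ^ d * eval2 P 1 0"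
  using eval2_homogeneous[OF assms, of "of_int p" 1 0] by (simp add: symbol_def)

section \<open>Rational approximation of the roots\<close>

text \<open>The Diophantine condition only concerns fractions near \<open>\<alpha>\<close>; farther away the distance is at
  least \<open>\<epsilon>\<close>. Making the exponent nonnegative lets one bound serve in both ranges.\<close>

lemma root_distance_lower_bound:
  assumes "\<And>\<alpha>. z = of_real \<alpha> \<Longrightarrow> diophantine_bound \<alpha>"
  shows "\<exists>C>0. \<exists>k\<ge>0. \<forall>p q::int. q > 0 \<longrightarrow>
           cmod (of_real (of_int p / of_int q) - z) \<ge> C * of_int q powr (- k)"
proof (cases "Im z = 0")
  case False
  have "cmod (of_real (of_int p / of_int q) - z) \<ge> \<bar>Im z\<bar> * of_int q powr (- 0)" if "q > 0" for p q :: int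
    using abs_Im_le_cmod[of "of_real (of_int p / of_int q) - z"] that by simp
  then show ?thesis using False by (intro exI[of _ "\<bar>Im z\<bar>"] conjI exI[of _ "0::real"]) auto
next
  case True
  define \<alpha> where "\<alpha> = Re z"
  have z: "z = of_real \<alpha>" using True by (simp add: \<alpha>_def complex_eq_iff)
  obtain C k \<epsilon> where C: "C > 0" "\<epsilon> > 0" and
    b: "\<And>p q::int. q > 0 \<Longrightarrow> \<bar>\<alpha> - of_int p / of_int q\<bar> < \<epsilon> \<Longrightarrow>
        \<bar>\<alpha> - of_int p / of_int q\<bar> > C / of_int q powr k"
    using assms[OF z] unfolding diophantine_bound_def by metis
  have "cmod (of_real (of_int p / of_int q) - z) \<ge> min C \<epsilon> * of_int q powr (- max k 0)"
    if q: "q > 0" for p q :: int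
  proof -
    have q1: "real_of_int q \<ge> 1" using q by simp
    have eq: "cmod (of_real (of_int p / of_int q) - z) = \<bar>\<alpha> - of_int p / of_int q\<bar>"
      by (simp only: z flip: of_real_diff) (simp only: norm_of_real abs_minus_commute)
    show ?thesis
    proof (cases "\<bar>\<alpha> - of_int p / of_int q\<bar> < \<epsilon>")
      case True
      have "min C \<epsilon> * of_int q powr (- max k 0) \<le> C * of_int q powr (- k)"
        using C q1 by (intro mult_mono powr_mono) auto
      also have "\<dots> = C / of_int q powr k" by (simp add: powr_minus divide_inverse)
      also have "\<dots> < \<bar>\<alpha> - of_int p / of_int q\<bar>" using b[OF q True] .
      finally show ?thesis using eq by simp
    next
      case False
      have "real_of_int q powr (- max k 0) \<le> real_of_int q powr 0"
        using q1 by (intro powr_mono) auto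
      then have "real_of_int q powr (- max k 0) \<le> 1" using q1 by simp
      then have "min C \<epsilon> * of_int q powr (- max k 0) \<le> \<epsilon> * 1"
        using C by (intro mult_mono) auto
      then show ?thesis using eq False by simp
    qed
  qed
  then show ?thesis using C
    by (intro exI[of _ "min C \<epsilon>"] conjI exI[of _ "max k 0"]) auto
qed

text \<open>Over the complex numbers \<open>Q\<close> is a constant times a product of factors \<open>x - z\<close>. Lower bounds
  of the form \<open>C q\<^bsup>-k\<^esup>\<close> multiply, the exponents adding up, so multiple roots need no separate
  treatment.\<close>

lemma poly_at_rationals_lower_bound:
  fixes Q :: "complex poly"
  assumes "Q \<noteq> 0"
    and roots: "\<And>\<alpha>. poly Q (of_real \<alpha>) = 0 \<Longrightarrow> diophantine_bound \<alpha>"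
  shows "\<exists>C>0. \<exists>k\<ge>0. \<forall>p q::int. q > 0 \<longrightarrow>
           cmod (poly Q (of_real (of_int p / of_int q))) \<ge> C * of_int q powr (- k)"
proof -
  have "\<exists>C>0. \<exists>k\<ge>0. \<forall>p q::int. q > 0 \<longrightarrow>
      cmod (poly (\<Prod>z\<in>#M. [:-z, 1:]) (of_real (of_int p / of_int q))) \<ge> C * of_int q powr (- k)"
    if "\<And>z \<alpha>. z \<in># M \<Longrightarrow> z = of_real \<alpha> \<Longrightarrow> diophantine_bound \<alpha>" for M
    using that
  proof (induction M)
    case empty
    show ?case by (intro exI[of _ "1::real"] conjI exI[of _ "0::real"]) auto
  next
    case (add z M)
    obtain C k where C: "C > 0" "k \<ge> 0" and
      b: "\<And>p q::int. q > 0 \<Longrightarrow>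
        cmod (poly (\<Prod>z\<in>#M. [:-z, 1:]) (of_real (of_int p / of_int q))) \<ge> C * of_int q powr (- k)"
      using add.IH add.prems by (metis union_iff add_mset_add_single)
    obtain C' k' where C': "C' > 0" "k' \<ge> 0" and
      b': "\<And>p q::int. q > 0 \<Longrightarrow>
        cmod (of_real (of_int p / of_int q) - z) \<ge> C' * of_int q powr (- k')"
      using root_distance_lower_bound[of z] add.prems by (metis union_single_eq_member)
    have "cmod (poly (\<Prod>z\<in>#add_mset z M. [:-z, 1:]) (of_real (of_int p / of_int q)))
        \<ge> (C' * C) * of_int q powr (- (k' + k))" if "q > 0" for p q :: int
    proof -
      have "(C' * of_int q powr (- k')) * (C * of_int q powr (- k)) \<le>
         cmod (of_real (of_int p / of_int q) - z) *
         cmod (poly (\<Prod>z\<in>#M. [:-z, 1:]) (of_real (of_int p / of_int q)))"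
        using b[OF that] b'[OF that] C C' by (intro mult_mono) auto
      also have "\<dots> = cmod (poly (\<Prod>z\<in>#add_mset z M. [:-z, 1:]) (of_real (of_int p / of_int q)))"
        by (simp add: algebra_simps flip: norm_mult)
      finally show ?thesis
        by (simp only: minus_add_distrib powr_add mult_ac)
    qed
    then show ?case using C C'
      by (intro exI[of _ "C' * C"] conjI exI[of _ "k' + k"]) auto
  qed
  moreover have "diophantine_bound \<alpha>" if "z \<in># proots Q" "z = of_real \<alpha>" for z \<alpha>
    using that roots assms(1) by auto
  ultimately obtain C k where C: "C > 0" "k \<ge> 0" and
      b: "\<And>p q::int. q > 0 \<Longrightarrow>
        cmod (poly (\<Prod>z\<in>#proots Q. [:-z, 1:]) (of_real (of_int p / of_int q))) \<ge> C * of_int q powr (- k)"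
    by metis
  have "cmod (poly Q x) = cmod (lead_coeff Q) * cmod (poly (\<Prod>z\<in>#proots Q. [:-z, 1:]) x)" for x
    by (subst complex_poly_decompose_multiset[of Q, symmetric]) (simp only: poly_smult norm_mult)
  then have "cmod (poly Q (of_real (of_int p / of_int q))) \<ge> (cmod (lead_coeff Q) * C) * of_int q powr (- k)"
    if "q > 0" for p q :: int
    using b[OF that, of p] by (simp add: mult.assoc mult_left_mono)
  then show ?thesis using C assms(1)
    by (intro exI[of _ "cmod (lead_coeff Q) * C"] conjI exI[of _ k]) auto
qed

lemma poly_bound_near_root:
  fixes Q :: "complex poly"
  assumes "poly Q (of_real \<alpha>) = 0"
  shows "\<exists>M>0. \<forall>x::real. \<bar>\<alpha> - x\<bar> < 1 \<longrightarrow> cmod (poly Q (of_real x)) \<le> M * \<bar>\<alpha> - x\<bar>"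
proof -
  obtain S where S: "Q = [:- of_real \<alpha>, 1:] * S"
    using assms by (auto simp: poly_eq_0_iff_dvd)
  have "bounded (poly S ` cball (of_real \<alpha>) 1)"
    by (intro compact_imp_bounded compact_continuous_image continuous_intros) auto
  then obtain M where M: "M > 0" "\<And>z. z \<in> cball (of_real \<alpha>) 1 \<Longrightarrow> cmod (poly S z) \<le> M"
    by (auto simp: bounded_pos)
  have "cmod (poly Q (of_real x)) \<le> M * \<bar>\<alpha> - x\<bar>" if "\<bar>\<alpha> - x\<bar> < 1" for x
  proof -
    have d: "cmod (of_real x - of_real \<alpha>) = \<bar>\<alpha> - x\<bar>"
      by (simp only: norm_of_real abs_minus_commute flip: of_real_diff)
    then have "cmod (poly S (of_real x)) \<le> M"
      using that by (intro M) (simp add: dist_norm norm_minus_commute)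
    then show ?thesis
      using mult_left_mono[of "cmod (poly S (of_real x))" M "\<bar>\<alpha> - x\<bar>"]
      by (simp add: S norm_mult mult.commute flip: d right_diff_distrib left_diff_distrib)
  qed
  then show ?thesis using M(1) by blast
qed

text \<open>The lower bound on the symbol only holds at frequencies of large weight, whereas \<open>q\<close> may be
  small, and \<open>p/q\<close> may even equal a rational root. Passing to a fixed large multiple
  \<open>(tp, tq)\<close> of the frequency removes the difficulty: the fraction \<open>p/q\<close> is unchanged, every
  such frequency has large weight, and by homogeneity the symbol changes only by the constant
  \<open>t\<^sup>d\<close>. Within distance 1 of \<open>\<alpha>\<close> the weight is at most \<open>K t\<^sup>2 q\<^sup>2\<close>, so the resulting bound is
  a power of \<open>q\<close>.\<close>

lemma diophantine_bound_if_symbol_lower_bound: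
  assumes hom: "homogeneous2 d P"
    and lower: "\<And>n. sobolev_weight n \<ge> R \<Longrightarrow> cmod (symbol P n) \<ge> sobolev_weight n powr (- k)"
    and root: "poly (subst2 P 1) (of_real \<alpha>) = 0"
  shows "diophantine_bound \<alpha>"
proof -
  obtain M where M: "M > 0"
    "\<And>x. \<bar>\<alpha> - x\<bar> < 1 \<Longrightarrow> cmod (poly (subst2 P 1) (of_real x)) \<le> M * \<bar>\<alpha> - x\<bar>"
    using poly_bound_near_root[OF root] by blast
  obtain t :: nat where t: "R \<le> real t" "t \<ge> 1"
    using real_arch_simple[of "max R 1"] by auto
  define l where "l = max k 0"
  \<comment> \<open>One unit of \<open>K\<close> pays for the constant 1 in the weight, one for \<open>(tq)\<^sup>2\<close>, and the square
    for \<open>(tp)\<^sup>2\<close>, as \<open>\<bar>p/q\<bar> < \<bar>\<alpha>\<bar> + 1\<close>.\<close>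
  define K where "K = 2 + (\<bar>\<alpha>\<bar> + 1)\<^sup>2"
  have K: "K > 0" unfolding K_def by (intro add_pos_nonneg) auto
  define A where "A = (K * (real t)\<^sup>2) powr (- l) / (real t ^ d * M)"
  have A: "A > 0" using K M t by (simp add: A_def)
  \<comment> \<open>The bound with \<open>A\<close> is weak; halving \<open>A\<close> makes it strict.\<close>
  have "A / 2 / of_int q powr (2 * l + real d) < \<bar>\<alpha> - of_int p / of_int q\<bar>"
    if q: "q > 0" and near: "\<bar>\<alpha> - of_int p / of_int q\<bar> < 1" for p q :: int
  proof -
    define x where "x = real_of_int p / real_of_int q"
    define n where "n = (int t * p, int t * q)"
    have q1: "real_of_int q \<ge> 1" using q by simp
    have t1: "real t \<ge> 1" using t by simp
    have px: "real_of_int p = x * real_of_int q" using q by (simp add: x_def)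
    have tq: "(real t)\<^sup>2 * (real_of_int q)\<^sup>2 \<ge> 1"
      using one_le_power[of "real t * of_int q" 2] mult_mono[of 1 "real t" 1 "of_int q"] q1 t1
      by (simp add: power_mult_distrib)
    have "real t \<le> (real t)\<^sup>2 * (real_of_int q)\<^sup>2"
    proof -
      have "real t * 1 \<le> (real t)\<^sup>2 * (real_of_int q)\<^sup>2"
        using q1 t1 by (intro mult_mono) (auto simp: self_le_power one_le_power)
      then show ?thesis by simp
    qed
    then have "sobolev_weight n \<ge> R"
      using t(1) by (simp add: n_def power_mult_distrib)
         (smt (verit) mult_nonneg_nonneg zero_le_power2)
    then have low: "cmod (symbol P n) \<ge> sobolev_weight n powr (- k)" by (rule lower)
    have "x\<^sup>2 \<le> (\<bar>\<alpha>\<bar> + 1)\<^sup>2"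
      using near by (intro abs_le_square_iff[THEN iffD1]) (auto simp: x_def)
    then have "x\<^sup>2 * ((real t)\<^sup>2 * (real_of_int q)\<^sup>2) \<le> (\<bar>\<alpha>\<bar> + 1)\<^sup>2 * ((real t)\<^sup>2 * (real_of_int q)\<^sup>2)"
      by (intro mult_right_mono) auto
    then have wK: "sobolev_weight n \<le> K * (real t)\<^sup>2 * (of_int q)\<^sup>2"
      using tq by (simp add: n_def px power_mult_distrib K_def algebra_simps)
    have symb: "cmod (symbol P n) \<le> real t ^ d * of_int q ^ d * (M * \<bar>\<alpha> - x\<bar>)"
    proof -
      have "cmod (symbol P n) = (real t * of_int q) ^ d * cmod (poly (subst2 P 1) (of_real x))"
        using symbol_eq_fraction[OF hom, of "int t * q" "int t * p"] q t
        by (simp add: n_def x_def abs_mult)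
      also have "\<dots> \<le> (real t * of_int q) ^ d * (M * \<bar>\<alpha> - x\<bar>)"
        using M(2)[of x] near q t by (intro mult_left_mono) (auto simp: x_def)
      finally show ?thesis by (simp add: power_mult_distrib)
    qed
    have "(K * (real t)\<^sup>2) powr (- l) * of_int q powr (- (2 * l))
        = (K * (real t)\<^sup>2 * (of_int q)\<^sup>2) powr (- l)"
    proof -
      have "real_of_int q powr (- (2 * l)) = (of_int q powr 2) powr (- l)"
        by (simp add: powr_powr)
      then show ?thesis using K q by (simp add: powr_mult powr_numeral)
    qed
    also have "\<dots> \<le> sobolev_weight n powr (- l)"
      using wK sobolev_weight_ge_1[of n] by (intro powr_mono2') (auto simp: l_def)
    also have "\<dots> \<le> sobolev_weight n powr (- k)"
      using sobolev_weight_ge_1[of n] by (intro powr_mono) (auto simp: l_def)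
    also have "\<dots> \<le> real t ^ d * of_int q ^ d * (M * \<bar>\<alpha> - x\<bar>)"
      using low symb by linarith
    finally have "(K * (real t)\<^sup>2) powr (- l) * of_int q powr (- (2 * l))
        \<le> real t ^ d * of_int q ^ d * (M * \<bar>\<alpha> - x\<bar>)" .
    then have "(K * (real t)\<^sup>2) powr (- l) * of_int q powr (- (2 * l)) / (real t ^ d * of_int q ^ d * M)
        \<le> \<bar>\<alpha> - x\<bar>"
      using t1 q M(1) by (subst pos_divide_le_eq) (auto simp: mult_ac)
    moreover have "(K * (real t)\<^sup>2) powr (- l) * of_int q powr (- (2 * l)) / (real t ^ d * of_int q ^ d * M)
        = A / of_int q powr (2 * l + real d)"
      using q by (simp add: A_def powr_add powr_minus powr_realpow divide_inverse)
    ultimately have "A / of_int q powr (2 * l + real d) \<le> \<bar>\<alpha> - x\<bar>"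
      by simp
    moreover have "A / 2 / of_int q powr (2 * l + real d) < A / of_int q powr (2 * l + real d)"
      using A q by (intro divide_strict_right_mono) auto
    ultimately show ?thesis by (simp add: x_def)
  qed
  then show ?thesis
    unfolding diophantine_bound_def using A
    by (intro exI[of _ "A / 2"] conjI exI[of _ "2 * l + real d"] exI[of _ "1::real"]) auto
qed

text \<open>Away from the origin the symbol is at least \<open>c w\<^bsup>-k\<^esup>\<close>: off the axis by the bound at
  rationals, since \<open>\<bar>q\<bar>\<close> is at most the weight \<open>w\<close>, and on the axis because \<open>P(1, 0) \<noteq> 0\<close>.
  For \<open>w \<ge> 1/c\<close> the constant \<open>c\<close> is absorbed by raising \<open>k\<close> by one.\<close>

lemma symbol_lower_bound:
  assumes hom: "homogeneous2 d P" and axis: "eval2 P 1 0 \<noteq> 0"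
    and roots: "\<And>\<alpha>. poly (subst2 P 1) (of_real \<alpha>) = 0 \<Longrightarrow> diophantine_bound \<alpha>"
  shows "\<exists>k R. \<forall>n. sobolev_weight n \<ge> R \<longrightarrow> cmod (symbol P n) \<ge> sobolev_weight n powr (- k)"
proof -
  obtain C k where C: "C > 0" "k \<ge> 0" and
    b: "\<And>p q::int. q > 0 \<Longrightarrow>
       cmod (poly (subst2 P 1) (of_real (of_int p / of_int q))) \<ge> C * of_int q powr (- k)"
    using poly_at_rationals_lower_bound[OF subst2_1_nonzero[OF hom] roots] by metis
  define c where "c = min C (cmod (eval2 P 1 0))"
  have c: "c > 0" using C axis by (simp add: c_def)
  have main: "c * sobolev_weight n powr (- k) \<le> cmod (symbol P n)" if "n \<noteq> (0, 0)" for n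
  proof -
    obtain p q where n: "n = (p, q)" by (cases n)
    note w = sobolev_weight_ge_1[of n]
    show ?thesis
    proof (cases "q = 0")
      case True
      then have "\<bar>real_of_int p\<bar> \<ge> 1" using that n by simp
      then have "1 \<le> \<bar>real_of_int p\<bar> ^ d" by (rule one_le_power)
      moreover have "sobolev_weight n powr (- k) \<le> sobolev_weight n powr 0"
        using w C by (intro powr_mono) auto
      moreover have "sobolev_weight n powr 0 = 1" using w by simp
      ultimately have "sobolev_weight n powr (- k) \<le> \<bar>real_of_int p\<bar> ^ d" by linarith
      then have "c * sobolev_weight n powr (- k) \<le> cmod (eval2 P 1 0) * \<bar>real_of_int p\<bar> ^ d"
        using c by (intro mult_mono) (auto simp: c_def)
      also have "\<dots> = cmod (symbol P n)"
        using symbol_axis[OF hom, of p] n True by (simp add: norm_mult norm_power)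
      finally show ?thesis .
    next
      case False
      define s where "s = \<bar>q\<bar>"
      have s: "s > 0" using False by (simp add: s_def)
      \<comment> \<open>The sign moves to the numerator, because the bound is for positive denominators.\<close>
      have frac: "real_of_int p / of_int q = of_int (sgn q * p) / of_int s"
        using False by (auto simp: s_def sgn_if abs_if)
      have s1: "real_of_int s \<ge> 1" using s by simp
      have "real_of_int s \<le> (of_int s)\<^sup>2" using s1 by (simp add: self_le_power)
      also have "\<dots> \<le> sobolev_weight n" by (simp add: n s_def)
      finally have "sobolev_weight n powr (- k) \<le> of_int s powr (- k)"
        using s C by (intro powr_mono2') auto
      then have "c * sobolev_weight n powr (- k) \<le> C * of_int s powr (- k)"
        using c by (intro mult_mono) (auto simp: c_def)
      also have "\<dots> \<le> cmod (poly (subst2 P 1) (of_real (of_int p / of_int q)))"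
        unfolding frac by (rule b[OF s])
      also have "\<dots> \<le> \<bar>real_of_int q\<bar> ^ d * cmod (poly (subst2 P 1) (of_real (of_int p / of_int q)))"
        using s1 by (intro mult_le_cancel_right1[THEN iffD2]) (auto simp: s_def one_le_power)
      also have "\<dots> = cmod (symbol P n)"
        using symbol_eq_fraction[OF hom False] n by simp
      finally show ?thesis .
    qed
  qed
  have "sobolev_weight n powr (- (k + 1)) \<le> cmod (symbol P n)"
    if R: "sobolev_weight n \<ge> max 2 (1 / c)" for n
  proof -
    have w: "sobolev_weight n > 0" using R by linarith
    have "n \<noteq> (0, 0)" using R by auto
    have "1 / sobolev_weight n \<le> c"
      using R c w by (simp add: field_simps)
    then have "1 / sobolev_weight n * sobolev_weight n powr (- k) \<le> c * sobolev_weight n powr (- k)"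
      by (intro mult_right_mono) auto
    moreover have "sobolev_weight n powr (- (k + 1)) = 1 / sobolev_weight n * sobolev_weight n powr (- k)"
      using w by (simp add: powr_diff powr_minus field_simps)
    ultimately show ?thesis using main[OF \<open>n \<noteq> (0, 0)\<close>] by linarith
  qed
  then show ?thesis by blast
qed

text \<open>If \<open>P(1, 0) = 0\<close>, the symbol vanishes at all frequencies of the axis, which have
  arbitrarily large weight.\<close>

lemma axis_nonzero_if_symbol_lower_bound:
  assumes hom: "homogeneous2 d P"
    and lower: "\<And>n. sobolev_weight n \<ge> R \<Longrightarrow> cmod (symbol P n) \<ge> sobolev_weight n powr (- k)"
  shows "eval2 P 1 0 \<noteq> 0"
proof
  assume zero: "eval2 P 1 0 = 0"
  obtain t :: nat where t: "R \<le> real t" using real_arch_simple by blast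
  have "real t \<le> 1 + (real t)\<^sup>2"
    by (cases "t = 0") (auto intro: order_trans[OF self_le_power[of "real t" 2]])
  then have "sobolev_weight (int t, 0) \<ge> R" using t by simp
  then have "cmod (symbol P (int t, 0)) > 0"
    using lower sobolev_weight_ge_1[of "(int t, 0)"]
    by (metis less_le_trans zero_less_one powr_gt_zero less_irrefl)
  then show False using symbol_axis[OF hom, of "int t"] zero by simp
qed

(* The conjunct P(1,0) \<noteq> 0 says that P(x,1) has full degree d, i.e. that infinity is not a
   root of it. It cannot be dropped: for P = x2^2 the polynomial P(x,1) = 1 has no roots,
   but every function of x1 alone is annihilated by the operator. *)
theorem proposition6:
  fixes P :: "complex poly poly" and d :: nat
  assumes "homogeneous2 d P" and "d \<ge> 2"
  shows "hypoelliptic (diff_op P) \<longleftrightarrow>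
           eval2 P 1 0 \<noteq> 0 \<and>
           (\<forall>\<alpha>::real. poly (subst2 P 1) (of_real \<alpha>) = 0 \<longrightarrow> diophantine_bound \<alpha>)"
  unfolding diff_op_eq_multiplier hypoelliptic_multiplier_iff
  using symbol_lower_bound[OF assms(1)] axis_nonzero_if_symbol_lower_bound[OF assms(1)]
    diophantine_bound_if_symbol_lower_bound[OF assms(1)]
  by metis

end
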